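(* Let $b>0$ and let $K\ge1$ be an integer. For every $D_{K+1}\ge 0$ there are constants $C_1(D_{K+1})$ and $C_2(D_{K+1})$ such that the following holds. Let $f:\mathbb{R}\to\mathbb{R}$ be a periodic function with period $2b$ that is either even or odd, and suppose that $f^{(K+1)}$ exists everywhere with $|f^{(K+1)}(x)|\le D_{K+1}$ for all $x$. Let $N=2M$ be an even positive integer and let $f_M$ be the trigonometric interpolant of $f$ defined in the context. Then for all $x\in\mathbb{R}$ $$|f_M(x)-f(x)|\le\frac{C_1(D_{K+1})}{N^{K}},$$ $$|f_M^{(k)}(x)-f^{(k)}(x)|\le\frac{C_2(D_{K+1})}{N^{K-k}},\qquad 1\le k<K.$$
   Context: For $N=2M$ put $x_k=-b+\frac{2b}{N}k$ and $y_k=f(x_k)$, $0\le k<N$. If $f$ is even, $f_M(x)=\sum_{0\le j<M}a_j\cos\frac{j\pi x}{b}$ with $a_0=\frac1M\sum_{0\le j<M}y_{2j}$ and $a_j=\frac2N\sum_{0\le k<N}(-1)^jy_k\cos\frac{2\pi jk}{N}$ for $1\le j<M$. If $f$ is odd, $f_M(x)=\sum_{0\le j<M}a_j\sin\frac{j\pi x}{b}$ with $a_j=\frac2N\sum_{0\le k<N}(-1)^jy_k\sin\frac{2\pi jk}{N}$ for $0\le j<M$. The constants may depend on $b$ and $K$, which are fixed, and on $D_{K+1}$, but not on $x$ or $N$. A superscript $(k)$ denotes the $k$-th derivative. *)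

theory Defs
  imports "HOL-Analysis.Analysis"
begin

definition node :: "real \<Rightarrow> nat \<Rightarrow> nat \<Rightarrow> real" where
  "node b N k = - b + 2 * b / real N * real k"

definition cos_coeff :: "real \<Rightarrow> (real \<Rightarrow> real) \<Rightarrow> nat \<Rightarrow> nat \<Rightarrow> real" where
  "cos_coeff b f M j =
     (let N = 2 * M; y = (\<lambda>k. f (node b N k)) in
      if j = 0 then 1 / real M * (\<Sum>i<M. y (2 * i))
      else 2 / real N * (\<Sum>k<N. (-1) ^ j * y k * cos (2 * pi * real j * real k / real N)))"

definition sin_coeff :: "real \<Rightarrow> (real \<Rightarrow> real) \<Rightarrow> nat \<Rightarrow> nat \<Rightarrow> real" where
  "sin_coeff b f M j =
     (let N = 2 * M; y = (\<lambda>k. f (node b N k)) in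
      2 / real N * (\<Sum>k<N. (-1) ^ j * y k * sin (2 * pi * real j * real k / real N)))"

definition even_fun :: "(real \<Rightarrow> real) \<Rightarrow> bool" where
  "even_fun f \<longleftrightarrow> (\<forall>x. f (- x) = f x)"

definition odd_fun :: "(real \<Rightarrow> real) \<Rightarrow> bool" where
  "odd_fun f \<longleftrightarrow> (\<forall>x. f (- x) = - f x)"

text \<open>Only used for functions that are even or odd. The zero function is the only one that is
  both, and there the two formulas agree.\<close>

definition trig_interpolant :: "real \<Rightarrow> (real \<Rightarrow> real) \<Rightarrow> nat \<Rightarrow> real \<Rightarrow> real" where
  "trig_interpolant b f M x =
     (if even_fun f
      then (\<Sum>j<M. cos_coeff b f M j * cos (real j * pi * x / b))
      else (\<Sum>j<M. sin_coeff b f M j * sin (real j * pi * x / b)))"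

text \<open>Existence of the \<open>n\<close>-th derivative on the whole line. \<^const>\<open>deriv\<close> is an arbitrary value
  where no derivative exists, so differentiability of each lower derivative is required
  explicitly.\<close>

definition times_differentiable :: "nat \<Rightarrow> (real \<Rightarrow> real) \<Rightarrow> bool" where
  "times_differentiable n f \<longleftrightarrow>
     (\<forall>j<n. \<forall>x. (deriv ^^ j) f field_differentiable (at x))"

end

theory Submission
  imports Defs "HOL-Library.Periodic_Fun"
begin

text \<open>
  Let \<open>d\<^sub>j\<close> be the discrete Fourier coefficients of \<open>f\<close> on \<open>N\<close> nodes. Shifting \<open>f\<close> by one mesh width
  multiplies \<open>d\<^sub>j\<close> by a root of unity, so the \<open>(K+1)\<close>-fold forward difference of \<open>f\<close>, which the mean
  value theorem bounds by \<open>D (2b/N)^(K+1)\<close>, gives \<open>d\<^sub>j = O(j^-(K+1))\<close> for \<open>1 \<le> j \<le> N/2\<close>, uniformly in \<open>N\<close>.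
  The coefficients for \<open>N\<close> and \<open>2N\<close> nodes differ by one aliased coefficient, so doubling \<open>M\<close> changes the
  \<open>k\<close>-th derivative of the interpolant by \<open>O(M^(k-K))\<close>. The interpolants of \<open>M, 2M, 4M, \<dots>\<close> therefore
  converge uniformly together with their derivatives of order \<open>k < K\<close>, with error dominated by a
  geometric series. They reproduce \<open>f\<close> at every second node, so their limit agrees with \<open>f\<close> on a dense
  set, hence everywhere. No convergence theorem for Fourier series is needed.
\<close>

section \<open>Chord lengths on the unit circle\<close>

text \<open>Jordan's inequality: \<open>sin\<close> is concave on \<open>[0, pi/2]\<close>, so it
  lies above the chord joining the endpoints of its graph.\<close>

lemma sin_ge_chord:
  fixes x :: real
  assumes "0 \<le> x" "x \<le> pi / 2"
  shows "2 * x / pi \<le> sin x"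
proof -
  have "concave_on {0..pi/2} (sin :: real \<Rightarrow> real)"
    by (rule f''_le0_imp_concave[where f' = cos and f'' = "\<lambda>x. - sin x"])
       (auto intro!: derivative_eq_intros sin_ge_zero)
  from concave_onD[OF this, of "2 * x / pi" 0 "pi/2"] show ?thesis
    using assms by (simp add: field_simps)
qed

lemma norm_cis_minus_1_ge:
  assumes "0 \<le> t" "t \<le> pi"
  shows "2 * t / pi \<le> norm (cis t - 1)"
proof -
  have "2 * (t / 2) / pi \<le> sin (t / 2)"
    by (rule sin_ge_chord) (use assms in auto)
  moreover have "norm (cis t - 1) = 2 * \<bar>sin (t / 2)\<bar>"
    by (metis dist_exp_i_1 cis_conv_exp)
  moreover have "sin (t/2) \<ge> 0" using assms by (intro sin_ge_zero) auto
  ultimately show ?thesis by simp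
qed

section \<open>Iterated forward differences\<close>

definition fwd_diff :: "real \<Rightarrow> (real \<Rightarrow> real) \<Rightarrow> real \<Rightarrow> real" where
  "fwd_diff h f x = f (x + h) - f x"

text \<open>Induction peels off the innermost difference. The differences \<open>G i\<close> of the
  \<open>F i\<close> again form a chain of derivatives, one shorter, and the mean value theorem
  bounds the last of them by \<open>h * D\<close>.\<close>

lemma fwd_diff_pow_bound:
  assumes "\<And>i x. i < n \<Longrightarrow> (F i has_real_derivative F (Suc i) x) (at x)"
    and "\<And>x. \<bar>F n x\<bar> \<le> D" and "h > 0"
  shows "\<bar>(fwd_diff h ^^ n) (F 0) x\<bar> \<le> h ^ n * D"
  using assms(1,2)
proof (induction n arbitrary: F D)
  case 0
  then show ?case by simp
next
  case (Suc n)
  define G where "G = (\<lambda>i. fwd_diff h (F i))"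
  have "\<bar>(fwd_diff h ^^ n) (G 0) x\<bar> \<le> h ^ n * (h * D)"
  proof (rule Suc.IH)
    fix i x assume "i < n"
    then have *: "(F i has_real_derivative F (Suc i) y) (at y)" for y
      using Suc.prems(1) by simp
    show "(G i has_real_derivative G (Suc i) x) (at x)"
      unfolding G_def fwd_diff_def
      by (rule DERIV_diff[OF _ *]) (use * DERIV_shift in blast)
  next
    fix x
    obtain z where "F n (x + h) - F n x = (x + h - x) * F (Suc n) z"
      using MVT2[of x "x + h" "F n" "F (Suc n)"] Suc.prems(1) \<open>h > 0\<close> by auto
    with Suc.prems(2)[of z] \<open>h > 0\<close> show "\<bar>G n x\<bar> \<le> h * D"
      by (simp add: G_def fwd_diff_def abs_mult)
  qed
  then show ?case by (simp add: funpow_swap1 G_def mult_ac)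
qed

lemma fwd_diff_pow_periodic:
  assumes "\<And>x. f (x + p) = f x"
  shows "(fwd_diff h ^^ n) f (x + p) = (fwd_diff h ^^ n) f x"
proof (induction n arbitrary: x)
  case (Suc n)
  have "x + p + h = (x + h) + p" by simp
  then have "(fwd_diff h ^^ n) f (x + p + h) = (fwd_diff h ^^ n) f (x + h)"
    using Suc[of "x + h"] by (simp only:)
  then show ?case using Suc[of x] by (simp add: fwd_diff_def[of h "(fwd_diff h ^^ n) f"])
qed (use assms in auto)

section \<open>Discrete Fourier coefficients and their decay\<close>

text \<open>The phase is taken at the node itself, so these are coefficients with respect to the
  functions \<open>cis (pi * j * x / b)\<close>. The sign \<open>(-1) ^ j\<close> of the classical
  formulas is thereby built in.\<close>

definition dft :: "real \<Rightarrow> nat \<Rightarrow> (real \<Rightarrow> real) \<Rightarrow> nat \<Rightarrow> complex" where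
  "dft b N f j = (\<Sum>k<N. f (node b N k) * cis (- (pi * j * node b N k / b))) / N"

text \<open>The sign arises because the nodes start at \<open>- b\<close>, half a period away from
  0.\<close>

lemma cis_node:
  assumes "b > 0" "N > 0"
  shows "cis (- (pi * real j * node b N k / b)) = (- 1) ^ j * cis (- (2 * pi * real j * real k / real N))"
proof -
  have "- (pi * real j * node b N k / b) = real j * pi + - (2 * pi * real j * real k / real N)"
    using assms by (simp add: node_def field_simps)
  also have "cis \<dots> = cis pi ^ j * cis (- (2 * pi * real j * real k / real N))"
    by (simp only: cis_mult [symmetric] Complex.DeMoivre)
  finally show ?thesis by simp
qed

lemma node_Suc: "node b N (Suc k) = node b N k + 2 * b / N"
  by (simp add: node_def algebra_simps add_divide_distrib)

lemma node_wrap: "N > 0 \<Longrightarrow> node b N N = node b N 0 + 2 * b"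
  by (simp add: node_def)

text \<open>Shifting the argument by one mesh width shifts the summation index by one. The terms for
  \<open>k = 0\<close> and \<open>k = N\<close> agree because the function and the phase both have
  period \<open>2 * b\<close>, so the cyclic sum is unchanged.\<close>

lemma dft_shift:
  assumes "b > 0" "N > 0" and per: "\<And>x. f (x + 2 * b) = f x"
  shows "dft b N (\<lambda>x. f (x + 2 * b / N)) j = cis (2 * pi * j / N) * dft b N f j"
proof -
  define e where "e = (\<lambda>k. cis (- (pi * j * node b N k / b)))"
  have e_Suc: "e k = cis (2 * pi * j / N) * e (Suc k)" for k
    using assms by (simp add: e_def node_Suc cis_mult field_simps)
  have "e N = e 0"
    unfolding e_def cis_node[OF assms(1,2)] using \<open>N > 0\<close> cis_multiple_2pi[of "real j"]
    by (simp add: cis_cnj[symmetric] mult_ac)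
  then have wrap: "f (node b N N) * e N = f (node b N 0) * e 0"
    using node_wrap[OF \<open>N > 0\<close>] per by simp
  have "(\<Sum>k<N. f (node b N (Suc k)) * e (Suc k)) = (\<Sum>k<N. f (node b N k) * e k)"
    using wrap sum.lessThan_Suc_shift[of "\<lambda>k. f (node b N k) * e k" N] by simp
  moreover have "dft b N (\<lambda>x. f (x + 2 * b / N)) j
      = cis (2 * pi * j / N) * (\<Sum>k<N. f (node b N (Suc k)) * e (Suc k)) / N"
  proof -
    have "f (node b N k + 2 * b / N) * cis (- (pi * j * node b N k / b))
        = cis (2 * pi * j / N) * (f (node b N (Suc k)) * e (Suc k))" for k
      using e_Suc[of k] by (simp add: node_Suc e_def)
    then show ?thesis unfolding dft_def sum_distrib_left by (simp only:)
  qed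
  ultimately show ?thesis by (simp add: dft_def e_def)
qed

text \<open>The shift acts on the coefficient as multiplication by a root of unity, so each forward
  difference contributes that root minus 1. Iterated differences stay periodic, which lets the shift
  rule be applied again.\<close>

lemma dft_fwd_diff_pow:
  assumes "b > 0" "N > 0" and per: "\<And>x. f (x + 2 * b) = f x"
  shows "dft b N ((fwd_diff (2 * b / N) ^^ n) f) j = (cis (2 * pi * j / N) - 1) ^ n * dft b N f j"
proof (induction n)
  case (Suc n)
  define g where "g = (fwd_diff (2 * b / N) ^^ n) f"
  have "dft b N (fwd_diff (2 * b / N) g) j = dft b N (\<lambda>x. g (x + 2 * b / N)) j - dft b N g j"
    by (simp add: dft_def fwd_diff_def left_diff_distrib sum_subtractf diff_divide_distrib)
  also have "\<dots> = (cis (2 * pi * j / N) - 1) * dft b N g j"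
    using dft_shift[OF assms(1,2), of g] fwd_diff_pow_periodic[of f, OF per]
    by (simp add: g_def left_diff_distrib)
  finally show ?case by (simp add: Suc g_def)
qed auto

lemma norm_dft_le:
  assumes "N > 0" "\<And>x. \<bar>f x\<bar> \<le> B"
  shows "norm (dft b N f j) \<le> B"
proof -
  have "norm (\<Sum>k<N. f (node b N k) * cis (- (pi * j * node b N k / b))) \<le> (\<Sum>k<N. B)"
    by (rule sum_norm_le) (use assms in \<open>auto simp: norm_mult\<close>)
  then show ?thesis using assms by (simp add: dft_def norm_divide field_simps)
qed

text \<open>The coefficient of the \<open>n\<close>-th difference is at most
  \<open>h ^ n * D\<close>, while the multiplier has modulus at least \<open>4 * j / N\<close> by
  Jordan's inequality; \<open>2 * j \<le> N\<close> keeps its angle in \<open>[0, pi]\<close>. In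
  the quotient \<open>N\<close> cancels, which makes the bound uniform in the grid.\<close>

lemma dft_decay:
  assumes "b > 0" "N > 0" and per: "\<And>x. f (x + 2 * b) = f x"
    and deriv: "\<And>i x. i < n \<Longrightarrow> ((deriv ^^ i) f has_real_derivative (deriv ^^ Suc i) f x) (at x)"
    and bound: "\<And>x. \<bar>(deriv ^^ n) f x\<bar> \<le> D"
    and j: "1 \<le> j" "2 * j \<le> N"
  shows "norm (dft b N f j) \<le> D * (b / 2) ^ n / j ^ n"
proof -
  define h where "h = 2 * b / real N"
  have "h > 0" using assms by (simp add: h_def)
  have "norm (dft b N ((fwd_diff h ^^ n) f) j) \<le> h ^ n * D"
    by (rule norm_dft_le[OF \<open>N > 0\<close>])
       (use fwd_diff_pow_bound[of n "\<lambda>i. (deriv ^^ i) f", OF deriv bound \<open>h > 0\<close>] in simp)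
  then have 1: "norm (cis (2 * pi * j / N) - 1) ^ n * norm (dft b N f j) \<le> h ^ n * D"
    unfolding h_def by (subst (asm) dft_fwd_diff_pow) (use assms in \<open>auto simp: norm_mult norm_power\<close>)
  have "2 * (2 * pi * j / N) / pi \<le> norm (cis (2 * pi * j / N) - 1)"
    using j \<open>N > 0\<close> by (intro norm_cis_minus_1_ge) (auto simp: field_simps simp flip: of_nat_mult)
  then have "(4 * j / N) ^ n \<le> norm (cis (2 * pi * j / N) - 1) ^ n"
    by (intro power_mono) auto
  with 1 have "(4 * j / N) ^ n * norm (dft b N f j) \<le> h ^ n * D"
    by (meson mult_right_mono norm_ge_zero order_trans)
  moreover have "(4 * j / N) ^ n > 0" using j \<open>N > 0\<close> by auto
  ultimately have "norm (dft b N f j) \<le> h ^ n * D / (4 * j / N) ^ n"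
    by (simp add: pos_le_divide_eq mult.commute)
  also have "\<dots> = D * (h / (4 * j / N)) ^ n" by (simp add: power_divide power_mult_distrib)
  also have "h / (4 * j / N) = b / 2 / j" using j \<open>N > 0\<close> by (simp add: h_def field_simps)
  finally show ?thesis by (simp add: power_divide)
qed

section \<open>Interpolation coefficients and aliasing\<close>

text \<open>The constant coefficient averages over every second node only. This absorbs the missing term
  \<open>j = M\<close> and makes the interpolant exact at the nodes of even index.\<close>

definition interp_coeff :: "real \<Rightarrow> (real \<Rightarrow> real) \<Rightarrow> nat \<Rightarrow> nat \<Rightarrow> complex" where
  "interp_coeff b f M j =
     (if j = 0 then complex_of_real ((\<Sum>i<M. f (node b (2 * M) (2 * i))) / M)
      else 2 * dft b (2 * M) f j)"

text \<open>The index \<open>k\<close> counts derivatives.\<close>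

definition trig_poly :: "real \<Rightarrow> nat \<Rightarrow> (nat \<Rightarrow> complex) \<Rightarrow> nat \<Rightarrow> real \<Rightarrow> real" where
  "trig_poly b M a k x =
     (\<Sum>j<M. Re ((\<i> * complex_of_real (pi * j / b)) ^ k * a j * cis (pi * j * x / b)))"

text \<open>The weight is 2 at even and 0 at odd indices. This is how a coarse grid is selected from
  a fine one.\<close>

lemma sum_even_terms:
  fixes g :: "nat \<Rightarrow> 'a::comm_ring_1"
  shows "(\<Sum>k<2*n. (1 + (-1) ^ k) * g k) = 2 * (\<Sum>k<n. g (2 * k))"
by (induction n) (simp_all add: distrib_left)

lemma node_double: "node b (2 * N) (2 * k) = node b N k"
  by (simp add: node_def)

text \<open>On the coarse grid the frequencies \<open>j\<close> and \<open>j - N\<close> coincide,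
  and for real \<open>f\<close> the coefficient at \<open>j - N\<close> is the conjugate of the one
  at \<open>N - j\<close>. On the fine grid the two phases differ by \<open>(-1) ^ k\<close>, so
  their sum keeps exactly the coarse nodes.\<close>

lemma dft_alias:
  assumes "b > 0" "N > 0" "even N" "j \<le> N"
  shows "dft b N f j = dft b (2 * N) f j + cnj (dft b (2 * N) f (N - j))"
proof -
  define e where "e = (\<lambda>k. cis (- (pi * j * node b (2 * N) k / b)))"
  have e': "cnj (cis (- (pi * real (N - j) * node b (2 * N) k / b))) = (-1) ^ k * e k" for k
  proof -
    have *: "2 * pi * real (N - j) * real k / real (2 * N)
        = real k * pi + - (2 * pi * real j * real k / real (2 * N))"
      using assms by (simp add: field_simps of_nat_diff)
    have "cis (2 * pi * real (N - j) * real k / real (2 * N))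
        = cis pi ^ k * cis (- (2 * pi * real j * real k / real (2 * N)))"
      unfolding * by (simp only: cis_mult [symmetric] Complex.DeMoivre)
    \<comment> \<open>Evenness of \<open>N\<close> makes the signs due to the starting node
      \<open>- b\<close> agree.\<close>
    moreover have "(-1::complex) ^ (N - j) = (-1) ^ j"
      using assms by (auto simp: minus_one_power_iff)
    ultimately show ?thesis
      unfolding e_def using assms
      by (subst (1 2) cis_node) (auto simp: cis_cnj)
  qed
  have "dft b (2 * N) f j + cnj (dft b (2 * N) f (N - j))
      = (\<Sum>k<2 * N. (1 + (-1) ^ k) * (complex_of_real (f (node b (2 * N) k)) * e k)) / (2 * N)"
    unfolding dft_def complex_cnj_divide cnj_sum complex_cnj_mult e' e_def[symmetric]
    by (simp add: e_def distrib_right sum.distrib add_divide_distrib mult_ac)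
  also have "\<dots> = dft b N f j"
    unfolding sum_even_terms node_double e_def dft_def by simp
  finally show ?thesis ..
qed

text \<open>With \<open>M\<close> the average runs over the nodes of even index, with
  \<open>2 * M\<close> over all nodes of the same grid. The difference is an alternating mean, that
  is, up to sign the coefficient at the highest frequency \<open>M\<close>, where the decay estimate
  is strong.\<close>

lemma interp_coeff_0_diff:
  assumes "b > 0" "M > 0"
  shows "interp_coeff b f M 0 - interp_coeff b f (2 * M) 0 = (-1) ^ M * dft b (2 * M) f M"
proof -
  define y where "y = (\<lambda>k. complex_of_real (f (node b (2 * M) k)))"
  have "cis (- (pi * real M * node b (2 * M) k / b)) = (-1) ^ M * (-1) ^ k" for k
  proof -
    have "- (2 * pi * real M * real k / real (2 * M)) = - (real k * pi)"
      using assms by simp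
    moreover have "cis (- (real k * pi)) = (-1) ^ k"
      by (metis Complex.DeMoivre cis_cnj cis_pi complex_cnj_minus complex_cnj_one complex_cnj_power)
    ultimately show ?thesis using cis_node[of b "2 * M" M k] assms by (simp only:)
  qed
  then have "(-1) ^ M * (y k * cis (- (pi * real M * node b (2 * M) k / b))) = y k * (-1) ^ k" for k
    by (cases "even M") (simp_all only: minus_one_power_iff if_True if_False, simp_all)
  then have "(\<Sum>k<2*M. (-1) ^ M * (y k * cis (- (pi * real M * node b (2 * M) k / b))))
      = (\<Sum>k<2*M. y k * (-1) ^ k)"
    by (simp only:)
  then have "(-1) ^ M * dft b (2 * M) f M = (\<Sum>k<2*M. y k * (-1) ^ k) / (2 * M)"
    by (simp add: dft_def y_def flip: sum_distrib_left)
  moreover have "interp_coeff b f (2 * M) 0 = (\<Sum>k<2*M. y k) / (2 * M)"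
    unfolding interp_coeff_def node_double by (simp add: y_def)
  moreover have "interp_coeff b f M 0 = (\<Sum>k<2*M. (1 + (-1) ^ k) * y k) / (2 * M)"
    unfolding sum_even_terms by (simp add: interp_coeff_def y_def)
  ultimately show ?thesis
    by (simp add: distrib_left sum.distrib add_divide_distrib mult.commute)
qed

section \<open>Exactness at the nodes of even index\<close>

text \<open>Real part of a geometric sum over powers of an \<open>N\<close>-th root of unity
  \<open>z\<close>, which vanishes unless \<open>z = 1\<close>.\<close>

lemma sum_cos_roots_of_unity:
  fixes m :: int
  assumes "N > 0"
  shows "(\<Sum>j<N. cos (2 * pi * real j * of_int m / real N)) = (if int N dvd m then real N else 0)"
proof -
  define z where "z = cis (2 * pi * of_int m / real N)"
  have "cos (2 * pi * real j * of_int m / real N) = Re (z ^ j)" for j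
    by (simp add: z_def Complex.DeMoivre mult_ac)
  then have *: "(\<Sum>j<N. cos (2 * pi * real j * of_int m / real N)) = Re (\<Sum>j<N. z ^ j)"
    by simp
  have zN: "z ^ N = 1"
    using assms cis_multiple_2pi[of "of_int m"] by (simp add: z_def Complex.DeMoivre mult_ac)
  have "z = 1 \<longleftrightarrow> int N dvd m"
  proof
    assume "z = 1"
    then have "cos (2 * pi * of_int m / real N) = 1"
      by (simp add: z_def complex_eq_iff)
    then obtain q :: int where "2 * pi * of_int m / real N = of_int q * 2 * pi"
      by (auto simp: cos_one_2pi_int)
    then have "real_of_int m = of_int (int N * q)" using assms by (simp add: field_simps)
    then show "int N dvd m" by (simp only: of_int_eq_iff) auto
  next
    assume "int N dvd m"
    then obtain q where "m = int N * q" by auto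
    then show "z = 1" using assms cis_multiple_2pi[of "of_int q"] by (simp add: z_def mult_ac)
  qed
  then show ?thesis unfolding * using zN by (auto simp: geometric_sum simp del: Re_sum)
qed

text \<open>The reflection of \<open>j\<close> to \<open>2 * M - j\<close> pairs all indices except
  0 and \<open>M\<close>.\<close>

lemma sum_symmetric:
  fixes g :: "nat \<Rightarrow> real"
  assumes "\<And>j. 0 < j \<Longrightarrow> j < M \<Longrightarrow> g (2 * M - j) = g j" "M > 0"
  shows "(\<Sum>j<2*M. g j) = g 0 + g M + 2 * (\<Sum>j=1..<M. g j)"
proof -
  have "{..<2*M} = {0,M} \<union> ({1..<M} \<union> {M+1..<2*M})" using assms by auto
  also have "sum g \<dots> = sum g {0,M} + (sum g {1..<M} + sum g {M+1..<2*M})"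
    by (subst sum.union_disjoint; simp; (subst sum.union_disjoint)?; force?)
  also have "sum g {M+1..<2*M} = sum g {1..<M}"
  proof (rule sum.reindex_bij_witness[where i = "\<lambda>j. 2*M-j" and j = "\<lambda>j. 2*M-j"])
    fix j assume "j \<in> {M+1..<2*M}"
    then show "g (2 * M - j) = g j" using assms(1)[of "2 * M - j"] by auto
  qed auto
  finally show ?thesis using assms by simp
qed

text \<open>Inserting the coefficients gives a sum of the samples \<open>y k\<close> against a
  cosine kernel. By symmetry the kernel is a full sum over \<open>j < N\<close>, and orthogonality
  leaves only the \<open>k\<close> congruent to \<open>n\<close> modulo \<open>N\<close>.
  Periodicity then identifies that sample with \<open>f x\<close>.\<close>

lemma trig_poly_exact_at_nodes:
  fixes n :: int
  assumes "b > 0" "M > 0" "even n" and per: "\<And>x. f (x + 2 * b) = f x"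
  defines "x \<equiv> - b + 2 * b / real (2 * M) * of_int n"
  shows "trig_poly b M (interp_coeff b f M) 0 x = f x"
proof -
  define N where "N = 2 * M"
  define y where "y = (\<lambda>k. f (node b N k))"
  define c where "c = (\<lambda>k j. cos (2 * pi * real j * of_int (n - int k) / real N))"
  have "N > 0" using assms by (simp add: N_def)
  have sym: "c k (N - j) = c k j" if "j < M" for k j
  proof -
    have "2 * pi * real (N - j) * of_int (n - int k) / real N
       = of_int (n - int k) * (2 * pi) - 2 * pi * real j * of_int (n - int k) / real N"
      using that \<open>N > 0\<close> by (simp add: N_def field_simps of_nat_diff)
    then show ?thesis
      unfolding c_def
      using sin_int_2pin[of "n - int k"] cos_int_2pin[of "n - int k"]
      by (simp only: cos_diff mult.commute[of "2 * pi"])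
  qed
  obtain q where q: "n = 2 * q" using \<open>even n\<close> by (rule evenE)
  \<comment> \<open>Here \<open>n\<close> must be even: the kernel term of frequency
    \<open>M\<close> then does not depend on \<open>n\<close>.\<close>
  have cM: "c k M = (-1) ^ k" for k
  proof -
    have "2 * pi * real M * of_int (n - int k) / real N = 2 * pi * of_int q - real k * pi"
      using assms q by (simp add: N_def field_simps)
    then show ?thesis
      using sin_int_2pin[of q] cos_int_2pin[of q] by (simp only: c_def cos_diff) simp
  qed
  have j: "Re (interp_coeff b f M j * cis (pi * j * x / b)) = 2 / N * (\<Sum>k<N. y k * c k j)" if "j \<noteq> 0" for j
  proof -
    have "cis (- (pi * j * node b N k / b)) * cis (pi * j * x / b)
       = cis (2 * pi * real j * of_int (n - int k) / real N)" for k
    proof -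
      have "- (pi * j * node b N k / b) + pi * j * x / b = pi * j * (x - node b N k) / b"
        using \<open>b > 0\<close> by (simp add: field_simps)
      also have "x - node b N k = b * (2 * of_int (n - int k) / real N)"
        unfolding x_def node_def N_def[symmetric] using \<open>N > 0\<close> by (simp add: field_simps)
      finally show ?thesis using \<open>b > 0\<close> by (simp add: cis_mult mult_ac)
    qed
    then show ?thesis using that
      by (simp add: interp_coeff_def dft_def N_def[symmetric] sum_distrib_right mult.assoc y_def c_def)
  qed
  \<comment> \<open>Averaging over even indices weights \<open>y k\<close> by
    \<open>1 + (-1) ^ k\<close>, so the constant coefficient supplies the kernel terms for both
    \<open>j = 0\<close> and \<open>j = M\<close>.\<close>
  have 0: "Re (interp_coeff b f M 0) = 1 / N * (\<Sum>k<N. y k * (1 + c k M))"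
    using sum_even_terms[of y M]
    by (simp add: interp_coeff_def cM N_def y_def mult_ac)
  have "trig_poly b M (interp_coeff b f M) 0 x = (\<Sum>j<M. Re (interp_coeff b f M j * cis (pi * j * x / b)))"
    by (simp add: trig_poly_def)
  also have "{..<M} = insert 0 {1..<M}" using assms by auto
  also have "(\<Sum>j\<in>\<dots>. Re (interp_coeff b f M j * cis (pi * j * x / b)))
     = 1 / N * (\<Sum>k<N. y k * (1 + c k M)) + (\<Sum>j=1..<M. 2 / N * (\<Sum>k<N. y k * c k j))"
    by (subst sum.insert) (simp_all only: finite_atLeastLessThan, auto simp: 0 j[simplified])
  also have "\<dots> = 1 / N * (\<Sum>k<N. y k * (c k 0 + c k M + 2 * (\<Sum>j=1..<M. c k j)))"
    unfolding sum_distrib_left by (subst sum.swap) (simp add: c_def distrib_left sum.distrib sum_distrib_left mult_ac)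
  also have "\<dots> = 1 / N * (\<Sum>k<N. y k * (\<Sum>j<N. c k j))"
    unfolding N_def by (subst sum_symmetric) (use sym assms in \<open>auto simp: N_def\<close>)
  also have "\<dots> = 1 / N * (\<Sum>k<N. if k = nat (n mod N) then y k * N else 0)"
  proof -
    have "int N dvd n - int k \<longleftrightarrow> k = nat (n mod N)" if "k < N" for k
      using that by (auto simp: mod_eq_dvd_iff[symmetric])
    then show ?thesis
      by (intro arg_cong2[where f = "(*)"] sum.cong refl)
         (auto simp: c_def sum_cos_roots_of_unity[OF \<open>N > 0\<close>] simp del: of_int_diff)
  qed
  also have "\<dots> = y (nat (n mod N))"
    using \<open>N > 0\<close> by (simp add: nat_less_iff)
  also have "\<dots> = f x"
  proof -
    interpret periodic_fun_simple f "2 * b" by standard (rule per)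
    have "real_of_int n = of_int (n mod N) + of_int (n div N) * real N"
      by (metis mod_div_mult_eq of_int_add of_int_mult of_int_of_nat_eq)
    then have "x = node b N (nat (n mod N)) + of_int (n div N) * (2 * b)"
      unfolding x_def node_def N_def[symmetric] using \<open>N > 0\<close> by (simp add: field_simps)
    then show ?thesis using plus_of_int by (simp add: y_def)
  qed
  finally show ?thesis .
qed

section \<open>Derivatives and differences of trigonometric polynomials\<close>

lemma has_real_derivative_Re_cis:
  "((\<lambda>x. Re (w * cis (c * x))) has_real_derivative Re (\<i> * complex_of_real c * w * cis (c * x))) (at x)"
  by (auto intro!: derivative_eq_intros simp: algebra_simps)

lemma has_real_derivative_trig_poly:
  "(trig_poly b M a k has_real_derivative trig_poly b M a (Suc k) x) (at x)"
proof -
  have "((\<lambda>x. Re ((\<i> * complex_of_real (pi * j / b)) ^ k * a j * cis (pi * j * x / b)))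
      has_real_derivative Re ((\<i> * complex_of_real (pi * j / b)) ^ Suc k * a j * cis (pi * j * x / b))) (at x)" for j
    using has_real_derivative_Re_cis[of "(\<i> * complex_of_real (pi * j / b)) ^ k * a j" "pi * j / b" x]
    by (simp add: mult.assoc)
  then show ?thesis unfolding trig_poly_def by (intro DERIV_sum)
qed

lemma deriv_pow_trig_poly: "(deriv ^^ k) (trig_poly b M a 0) = trig_poly b M a k"
  by (induction k) (auto intro!: DERIV_imp_deriv has_real_derivative_trig_poly)

text \<open>Termwise estimate after padding the shorter polynomial with zeros. Counting
  \<open>M'\<close> terms costs one power of \<open>M'\<close>, which is why \<open>K + 1\<close>
  derivatives of \<open>f\<close> yield only the rate \<open>K\<close>.\<close>

lemma trig_poly_diff_bound:
  assumes "b > 0" "M \<le> M'"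
    and B: "\<And>j. j < M' \<Longrightarrow> norm (a' j - (if j < M then a j else 0)) \<le> B"
  shows "\<bar>trig_poly b M' a' k x - trig_poly b M a k x\<bar> \<le> M' * ((pi * M' / b) ^ k * B)"
proof -
  define d where "d = (\<lambda>j. a' j - (if j < M then a j else 0))"
  define t where "t = (\<lambda>u j. Re ((\<i> * complex_of_real (pi * real j / b)) ^ k * u * cis (pi * j * x / b)))"
  have trig_poly: "trig_poly b L c k x = (\<Sum>j<L. t (c j) j)" for L c
    by (simp add: trig_poly_def t_def)
  have t_diff: "t u j - t v j = t (u - v) j" for u v j
    by (simp only: t_def left_diff_distrib right_diff_distrib minus_complex.simps)
  have "(\<Sum>j<M. t (a j) j) = (\<Sum>j<M'. t (if j < M then a j else 0) j)"
    by (rule sum.mono_neutral_cong_left) (use assms in \<open>auto simp: t_def\<close>)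
  then have "trig_poly b M' a' k x - trig_poly b M a k x = (\<Sum>j<M'. t (d j) j)"
    by (simp only: trig_poly sum_subtractf[symmetric] t_diff d_def)
  also have "\<bar>\<dots>\<bar> \<le> (\<Sum>j<M'. (pi * M' / b) ^ k * B)"
  proof (rule order_trans[OF sum_abs sum_mono])
    fix j assume j: "j \<in> {..<M'}"
    have "\<bar>t (d j) j\<bar> \<le> norm ((\<i> * complex_of_real (pi * real j / b)) ^ k * d j * cis (pi * j * x / b))"
      unfolding t_def by (rule abs_Re_le_cmod)
    also have "\<dots> = (pi * j / b) ^ k * norm (d j)"
      using \<open>b > 0\<close> by (simp add: norm_mult norm_power norm_divide)
    also have "\<dots> \<le> (pi * M' / b) ^ k * B"
      by (rule mult_mono) (use j B \<open>b > 0\<close> in \<open>auto intro!: power_mono divide_right_mono simp: d_def\<close>)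
    finally show "\<bar>t (d j) j\<bar> \<le> (pi * M' / b) ^ k * B" .
  qed
  finally show ?thesis by simp
qed

section \<open>Convergence under doubling of the grid\<close>

text \<open>The Weierstrass M-test applies to the telescoping series; the factor 2 is the sum of the
  powers of \<open>1/2\<close>.\<close>

lemma geometric_uniform_limit:
  fixes g :: "nat \<Rightarrow> 'a \<Rightarrow> real"
  assumes "\<And>r x. \<bar>g (Suc r) x - g r x\<bar> \<le> B * (1/2) ^ r"
  obtains l where "uniform_limit UNIV g l sequentially" "\<And>x. \<bar>g 0 x - l x\<bar> \<le> 2 * B"
proof -
  define l where "l = (\<lambda>x. g 0 x + (\<Sum>r. g (Suc r) x - g r x))"
  have sums: "(\<lambda>r. B * (1/2) ^ r) sums (B * 2)"
    using geometric_sums[of "1/2::real"] sums_mult by fastforce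
  have lim: "uniform_limit UNIV (\<lambda>n x. \<Sum>r<n. g (Suc r) x - g r x) (\<lambda>x. \<Sum>r. g (Suc r) x - g r x) sequentially"
    by (rule Weierstrass_m_test[OF _ sums_summable[OF sums]]) (use assms in auto)
  have telescope: "(\<Sum>r<n. g (Suc r) x - g r x) = g n x - g 0 x" for n x
    by (rule sum_lessThan_telescope)
  from uniform_limit_add[OF uniform_limit_const[where c = "g 0"] lim]
  have "uniform_limit UNIV g l sequentially"
    by (simp add: l_def telescope)
  moreover have "\<bar>g 0 x - l x\<bar> \<le> 2 * B" for x
  proof -
    have "\<bar>\<Sum>r. g (Suc r) x - g r x\<bar> \<le> (\<Sum>r. B * (1/2) ^ r)"
      using norm_suminf_le[of "\<lambda>r. g (Suc r) x - g r x", OF _ sums_summable[OF sums]] assms by simp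
    then show ?thesis using sums_unique[OF sums] by (simp add: l_def)
  qed
  ultimately show ?thesis using that by blast
qed

text \<open>Common complex form of the cosine and the sine interpolant, together with its
  derivatives; \<open>trig_interpolant_eq\<close> makes the identification.\<close>

definition interpolant :: "real \<Rightarrow> (real \<Rightarrow> real) \<Rightarrow> nat \<Rightarrow> nat \<Rightarrow> real \<Rightarrow> real" where
  "interpolant b f M = trig_poly b M (interp_coeff b f M)"

text \<open>Every change of a coefficient is governed by a discrete coefficient of index at least
  \<open>M\<close>: index \<open>M\<close> itself for \<open>j = 0\<close>, the alias
  \<open>2 * M - j\<close> for \<open>0 < j < M\<close>, and the new coefficient for
  \<open>j \<ge> M\<close>. All of these are of order \<open>M\<close> to the power
  \<open>-(K + 1)\<close>.\<close>

lemma interpolant_refine: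
  assumes "b > 0" "M > 0" "k < K" and per: "\<And>x. f (x + 2 * b) = f x"
    and deriv: "\<And>i x. i < Suc K \<Longrightarrow> ((deriv ^^ i) f has_real_derivative (deriv ^^ Suc i) f x) (at x)"
    and bound: "\<And>x. \<bar>(deriv ^^ Suc K) f x\<bar> \<le> D"
  shows "\<bar>interpolant b f (2 * M) k x - interpolant b f M k x\<bar>
    \<le> 4 * D * (b / 2) ^ Suc K * (1 + 2 * pi / b) ^ K / M ^ (K - k)"
proof -
  define E where "E = D * (b / 2) ^ Suc K"
  have "D \<ge> 0" using bound[of 0] by linarith
  then have "E \<ge> 0" using \<open>b > 0\<close> by (simp add: E_def)
  have decay: "norm (dft b (2 * L) f j) \<le> E / M ^ Suc K" if "M \<le> j" "j \<le> L" for L j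
  proof -
    have "norm (dft b (2 * L) f j) \<le> E / j ^ Suc K"
      unfolding E_def using that \<open>M > 0\<close> \<open>b > 0\<close> deriv bound
      by (intro dft_decay per) auto
    also have "\<dots> \<le> E / M ^ Suc K"
      using that \<open>M > 0\<close> \<open>E \<ge> 0\<close> power_mono[of "real M" "real j" "Suc K"]
      by (intro divide_left_mono mult_pos_pos zero_less_power) auto
    finally show ?thesis .
  qed
  have "norm (interp_coeff b f (2 * M) j - (if j < M then interp_coeff b f M j else 0))
      \<le> 2 * (E / M ^ Suc K)" if "j < 2 * M" for j
  proof -
    consider "j = 0" | "0 < j" "j < M" | "M \<le> j" by linarith
    then show ?thesis
    proof cases
      case 1
      have "norm (interp_coeff b f (2 * M) 0 - interp_coeff b f M 0) = norm (dft b (2 * M) f M)"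
        using interp_coeff_0_diff[of b M f] \<open>b > 0\<close> \<open>M > 0\<close>
        by (subst norm_minus_commute) (simp add: norm_mult norm_power)
      also have "\<dots> \<le> 2 * (E / M ^ Suc K)"
        using decay[of M M] norm_ge_zero[of "dft b (2 * M) f M"] by linarith
      finally show ?thesis using 1 \<open>M > 0\<close> by simp
    next
      case 2
      have "interp_coeff b f (2 * M) j - interp_coeff b f M j
          = - 2 * cnj (dft b (2 * (2 * M)) f (2 * M - j))"
        using 2 dft_alias[of b "2 * M" j f] \<open>b > 0\<close> by (simp add: interp_coeff_def)
      then show ?thesis
        using 2 decay[of "2 * M - j" "2 * M"] by (simp add: norm_mult Suc_leI le_diff_conv2)
    next
      case 3
      then show ?thesis
        using decay[of j "2 * M"] that \<open>M > 0\<close> by (simp add: interp_coeff_def norm_mult)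
    qed
  qed
  then have "\<bar>interpolant b f (2 * M) k x - interpolant b f M k x\<bar>
    \<le> real (2 * M) * ((pi * real (2 * M) / b) ^ k * (2 * (E / M ^ Suc K)))"
    unfolding interpolant_def by (intro trig_poly_diff_bound) (use \<open>b > 0\<close> in auto)
  \<comment> \<open>The number of terms uses up one of the \<open>K + 1\<close> powers of
    \<open>M\<close> and the derivatives use \<open>k\<close>. The 4 combines \<open>2 * M\<close>
    terms with the factor 2 of the coefficients.\<close>
  also have "\<dots> = 4 * E * (2 * pi / b) ^ k * (M ^ k / M ^ K)"
    using \<open>M > 0\<close> by (simp add: power_mult_distrib power_divide field_simps)
  also have "\<dots> = 4 * E * (2 * pi / b) ^ k * (1 / M ^ (K - k))"
    using \<open>M > 0\<close> \<open>k < K\<close> by (simp add: power_diff_conv_inverse field_simps)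
  \<comment> \<open>Since \<open>2 * pi / b\<close> may be below 1, adding 1 is what allows the
    exponent \<open>k\<close> to be raised to \<open>K\<close>, giving one constant for all
    \<open>k < K\<close>.\<close>
  also have "\<dots> \<le> 4 * E * (1 + 2 * pi / b) ^ K * (1 / M ^ (K - k))"
  proof -
    have "(2 * pi / b) ^ k \<le> (1 + 2 * pi / b) ^ k"
      using \<open>b > 0\<close> by (intro power_mono) auto
    also have "\<dots> \<le> (1 + 2 * pi / b) ^ K"
      using \<open>b > 0\<close> \<open>k < K\<close> by (intro power_increasing) auto
    finally show ?thesis
      using \<open>E \<ge> 0\<close> by (intro mult_right_mono mult_left_mono) auto
  qed
  finally show ?thesis by (simp add: E_def mult.assoc)
qed

lemma times_differentiable_DERIV:
  assumes "times_differentiable n f" "i < n"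
  shows "((deriv ^^ i) f has_real_derivative (deriv ^^ Suc i) f x) (at x)"
  using assms by (simp add: times_differentiable_def field_differentiable_derivI)

text \<open>Rounding down to the grid of spacing \<open>1 / T s\<close> errs by at most
  \<open>1 / T s\<close>. This provides the density of the nodes.\<close>

lemma grid_floor_approx:
  fixes T :: "nat \<Rightarrow> real"
  assumes "(\<lambda>s. 1 / T s) \<longlonglongrightarrow> 0" "\<And>s. T s > 0"
  shows "(\<lambda>s. of_int \<lfloor>y * T s\<rfloor> / T s) \<longlonglongrightarrow> y"
proof (rule tendsto_sandwich)
  show "\<forall>\<^sub>F s in sequentially. y - 1 / T s \<le> of_int \<lfloor>y * T s\<rfloor> / T s"
  proof (intro always_eventually allI)
    fix s
    have "(y * T s - 1) / T s \<le> of_int \<lfloor>y * T s\<rfloor> / T s"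
      using assms(2)[of s] by (intro divide_right_mono) linarith+
    then show "y - 1 / T s \<le> of_int \<lfloor>y * T s\<rfloor> / T s"
      using assms(2)[of s] by (simp add: diff_divide_distrib)
  qed
  show "\<forall>\<^sub>F s in sequentially. of_int \<lfloor>y * T s\<rfloor> / T s \<le> y"
    using assms(2) by (intro always_eventually) (simp add: divide_le_eq)
  from tendsto_diff[OF tendsto_const assms(1)]
  show "(\<lambda>s. y - 1 / T s) \<longlonglongrightarrow> y" by simp
qed auto

locale smooth_periodic =
  fixes b :: real and f :: "real \<Rightarrow> real" and K :: nat and D :: real
  assumes b_pos: "b > 0"
    and periodic: "\<And>x. f (x + 2 * b) = f x"
    and differentiable: "times_differentiable (Suc K) f"
    and bounded: "\<And>x. \<bar>(deriv ^^ Suc K) f x\<bar> \<le> D"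
begin

text \<open>The constant of one doubling step in \<open>interpolant_refine\<close>; it depends only
  on \<open>b\<close>, \<open>K\<close> and \<open>D\<close>.\<close>

definition C where "C = 4 * D * (b / 2) ^ Suc K * (1 + 2 * pi / b) ^ K"

lemma C_nonneg: "C \<ge> 0"
proof -
  have "D \<ge> 0" using bounded[of 0] by linarith
  then show ?thesis using b_pos by (simp add: C_def)
qed

text \<open>Because \<open>k < K\<close>, each doubling shrinks the step bound by a factor of at
  most \<open>1/2\<close>, so the steps are dominated by a geometric series.\<close>

lemma interpolant_limit_exists:
  assumes "M > 0" "k < K"
  obtains l where "uniform_limit UNIV (\<lambda>r. interpolant b f (2 ^ r * M) k) l sequentially"
    "\<And>x. \<bar>interpolant b f M k x - l x\<bar> \<le> 2 * (C / M ^ (K - k))"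
proof -
  define g where "g = (\<lambda>r. interpolant b f (2 ^ r * M) k)"
  have step: "\<bar>g (Suc r) x - g r x\<bar> \<le> C / M ^ (K - k) * (1 / 2) ^ r" for r x
  proof -
    have "\<bar>g (Suc r) x - g r x\<bar> \<le> C / real (2 ^ r * M) ^ (K - k)"
      using interpolant_refine[of b "2 ^ r * M" k K f D x]
        times_differentiable_DERIV[OF differentiable] b_pos periodic bounded assms
      unfolding g_def C_def by (simp add: mult.assoc)
    also have "\<dots> = C / M ^ (K - k) * (1 / 2 ^ (r * (K - k)))"
      by (simp add: power_mult_distrib power_mult)
    also have "\<dots> \<le> C / M ^ (K - k) * (1 / 2 ^ r)"
      using assms C_nonneg
      by (intro mult_left_mono divide_left_mono power_increasing) auto
    finally show ?thesis by (simp add: power_divide)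
  qed
  show ?thesis
    using geometric_uniform_limit[of g, OF step] that by (auto simp: g_def)
qed

text \<open>For \<open>k = 0\<close> the uniform limit is continuous and agrees with
  \<open>f\<close> on a dense set of nodes. In the induction step the derivatives converge
  uniformly, so their limit is the derivative of the limit already identified.\<close>

lemma interpolant_tendsto:
  assumes "M > 0" "k < K"
  shows "(\<lambda>r. interpolant b f (2 ^ r * M) k x) \<longlonglongrightarrow> (deriv ^^ k) f x"
  using assms(2)
proof (induction k arbitrary: x)
  case 0
  obtain l where l: "uniform_limit UNIV (\<lambda>r. interpolant b f (2 ^ r * M) 0) l sequentially"
    by (rule interpolant_limit_exists[OF assms(1) 0]) (rule that)
  have "continuous_on UNIV (interpolant b f (2 ^ r * M) 0)" for r
    unfolding interpolant_def
    by (rule DERIV_continuous_on) (rule has_field_derivative_at_within[OF has_real_derivative_trig_poly])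
  then have "continuous_on UNIV l"
    by (intro uniform_limit_theorem[OF always_eventually l]) auto
  have "isCont f x"
    using times_differentiable_DERIV[OF differentiable, of 0 x] by (auto intro: DERIV_isCont)
  \<comment> \<open>\<open>1 / T s\<close> is the spacing of the even-indexed nodes after
    \<open>s\<close> doublings, and \<open>z s\<close> is the last of these nodes not beyond
    \<open>x\<close>.\<close>
  define T where "T = (\<lambda>s. 2 ^ s * M / (2 * b))"
  define z where "z = (\<lambda>s. - b + of_int \<lfloor>(x + b) * T s\<rfloor> / T s)"
  have "(\<lambda>s. 2 * b / M * (1 / 2) ^ s) \<longlonglongrightarrow> 2 * b / M * 0"
    by (intro tendsto_intros LIMSEQ_power_zero) auto
  then have "(\<lambda>s. 1 / T s) \<longlonglongrightarrow> 0"
    by (simp add: T_def field_simps)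
  from tendsto_add[OF tendsto_const grid_floor_approx[OF this, of "x + b"], of "- b"]
  have z: "z \<longlonglongrightarrow> x"
    unfolding z_def using assms b_pos by (simp add: T_def)
  have lz: "l (z s) = f (z s)" for s
  proof -
    define q where "q = \<lfloor>(x + b) * T s\<rfloor>"
    have "interpolant b f (2 ^ r * M) 0 (z s) = f (z s)" if "r \<ge> s" for r
    proof -
      have "2 ^ r = 2 ^ (r - s) * (2 ^ s :: real)"
        using that by (simp flip: power_add)
      \<comment> \<open>On every later grid this node still has an even index, so those interpolants
        all reproduce \<open>f\<close> there.\<close>
      then have "z s = - b + 2 * b / real (2 * (2 ^ r * M)) * of_int (2 * (2 ^ (r - s) * q))"
        unfolding z_def q_def[symmetric] using assms b_pos by (simp add: T_def field_simps)
      then show ?thesis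
        unfolding interpolant_def
        using trig_poly_exact_at_nodes[of b "2 ^ r * M" "2 * (2 ^ (r - s) * q)" f, OF b_pos _ _ periodic] assms
        by (simp only:) simp
    qed
    then have "(\<lambda>r. interpolant b f (2 ^ r * M) 0 (z s)) \<longlonglongrightarrow> f (z s)"
      by (intro tendsto_eventually eventually_sequentiallyI)
    then show ?thesis
      by (rule LIMSEQ_unique[OF tendsto_uniform_limitI[OF l UNIV_I]])
  qed
  have "(\<lambda>s. l (z s)) \<longlonglongrightarrow> l x"
    by (rule continuous_on_tendsto_compose[OF \<open>continuous_on UNIV l\<close> z]) auto
  moreover have "(\<lambda>s. l (z s)) \<longlonglongrightarrow> f x"
    unfolding lz using \<open>isCont f x\<close> z by (rule isCont_tendsto_compose)
  ultimately have "l x = f x" by (rule LIMSEQ_unique)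
  then show ?case using tendsto_uniform_limitI[OF l, of x] by simp
next
  case (Suc k)
  obtain l where l: "uniform_limit UNIV (\<lambda>r. interpolant b f (2 ^ r * M) (Suc k)) l sequentially"
    by (rule interpolant_limit_exists[OF assms(1) Suc.prems]) (rule that)
  have "\<exists>g. \<forall>x\<in>UNIV. (\<lambda>r. interpolant b f (2 ^ r * M) k x) \<longlonglongrightarrow> g x \<and> (g has_derivative (*) (l x)) (at x)"
  proof (rule has_derivative_sequence)
    show "(interpolant b f (2 ^ r * M) k has_derivative (*) (interpolant b f (2 ^ r * M) (Suc k) x)) (at x)" for r x
      unfolding interpolant_def using has_real_derivative_trig_poly by (simp add: has_field_derivative_def)
    \<comment> \<open>Convergence is required at one point only; 0 is an arbitrary choice.\<close>
    show "(\<lambda>r. interpolant b f (2 ^ r * M) k 0) \<longlonglongrightarrow> (deriv ^^ k) f 0"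
      using Suc by simp
    fix e :: real assume "e > 0"
    from uniform_limitD[OF l this]
    show "\<forall>\<^sub>F r in sequentially. \<forall>x\<in>UNIV. \<forall>h. norm (interpolant b f (2 ^ r * M) (Suc k) x * h - l x * h) \<le> e * norm h"
      by eventually_elim
         (simp only: dist_norm left_diff_distrib[symmetric] norm_mult, meson less_imp_le mult_right_mono norm_ge_zero)
  qed auto
  then obtain g where g: "\<forall>x\<in>UNIV. (\<lambda>r. interpolant b f (2 ^ r * M) k x) \<longlonglongrightarrow> g x
      \<and> (g has_derivative (*) (l x)) (at x)" ..
  have "g = (deriv ^^ k) f"
  proof
    fix x
    show "g x = (deriv ^^ k) f x"
      using g Suc.IH[of x] Suc.prems LIMSEQ_unique by (meson UNIV_I Suc_lessD)
  qed
  moreover have "(g has_real_derivative l x) (at x)"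
    using g by (simp add: has_field_derivative_def)
  ultimately have "(deriv ^^ Suc k) f x = l x"
    by (simp add: DERIV_imp_deriv)
  then show ?case using tendsto_uniform_limitI[OF l, of x] by simp
qed

lemma interpolant_error:
  assumes "M > 0" "k < K"
  shows "\<bar>interpolant b f M k x - (deriv ^^ k) f x\<bar> \<le> 2 * C * 2 ^ K / real (2 * M) ^ (K - k)"
proof -
  obtain l where l: "uniform_limit UNIV (\<lambda>r. interpolant b f (2 ^ r * M) k) l sequentially"
    "\<And>x. \<bar>interpolant b f M k x - l x\<bar> \<le> 2 * (C / M ^ (K - k))"
    by (rule interpolant_limit_exists[OF assms]) (rule that)
  have "l x = (deriv ^^ k) f x"
    by (rule LIMSEQ_unique[OF tendsto_uniform_limitI[OF l(1) UNIV_I] interpolant_tendsto[OF assms]])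
  with l(2)[of x] have "\<bar>interpolant b f M k x - (deriv ^^ k) f x\<bar> \<le> 2 * C / M ^ (K - k)"
    by simp
  \<comment> \<open>Passing from \<open>M\<close> to \<open>N = 2 * M\<close> costs
    \<open>2 ^ (K - k)\<close>, enlarged next to \<open>2 ^ K\<close> so that the constant does not
    depend on \<open>k\<close>.\<close>
  also have "\<dots> = 2 * C * 2 ^ (K - k) / real (2 * M) ^ (K - k)"
    by (simp add: power_mult_distrib)
  also have "\<dots> \<le> 2 * C * 2 ^ K / real (2 * M) ^ (K - k)"
    using C_nonneg by (intro divide_right_mono mult_left_mono power_increasing) auto
  finally show ?thesis .
qed

end

section \<open>Parity and the cosine and sine forms\<close>

text \<open>Reflecting \<open>k\<close> to \<open>n - k\<close> turns the sum over
  \<open>0 < k < n\<close> into its negative.\<close>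

lemma sum_antisymmetric:
  fixes g :: "nat \<Rightarrow> real"
  assumes "g 0 = 0" "\<And>k. 0 < k \<Longrightarrow> k < n \<Longrightarrow> g (n - k) = - g k"
  shows "(\<Sum>k<n. g k) = 0"
proof -
  have "(\<Sum>k<n. g k) = (\<Sum>k=1..<n. g k)"
    using assms(1) by (intro sum.mono_neutral_right) (auto simp: Suc_le_eq)
  moreover have "(\<Sum>k=1..<n. g k) = (\<Sum>k=1..<n. g (n - k))"
    by (rule sum.reindex_bij_witness[where i = "\<lambda>k. n - k" and j = "\<lambda>k. n - k"]) auto
  moreover have "(\<Sum>k=1..<n. g (n - k)) = - (\<Sum>k=1..<n. g k)"
    unfolding sum_negf[symmetric] using assms(2) by (intro sum.cong) auto
  ultimately show ?thesis by simp
qed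

lemma node_reflect:
  assumes "b > 0" "N > 0" "k \<le> N"
  shows "node b N (N - k) = - node b N k"
  using assms by (simp add: node_def of_nat_diff field_simps)

text \<open>For \<open>j > 0\<close> the complex coefficient is \<open>cos_coeff\<close> minus
  \<open>\<i>\<close> times \<open>sin_coeff\<close>.\<close>

lemma Re_interp_term:
  assumes "b > 0" "M > 0" "j > 0"
  shows "Re (interp_coeff b f M j * cis t) = cos_coeff b f M j * cos t + sin_coeff b f M j * sin t"
proof -
  define N where "N = 2 * M"
  have "N > 0" using assms by (simp add: N_def)
  have sign: "Re ((-1) ^ j * z) = (-1) ^ j * Re z" "Im ((-1) ^ j * z) = (-1) ^ j * Im z" for z :: complex
    by (cases "even j"; simp)+
  have "interp_coeff b f M j = Complex (cos_coeff b f M j) (- sin_coeff b f M j)"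
    using assms
    unfolding interp_coeff_def dft_def cos_coeff_def sin_coeff_def complex_eq_iff N_def[symmetric] Let_def
      cis_node[OF \<open>b > 0\<close> \<open>N > 0\<close>]
    by (simp add: sign sum_negf mult.left_commute mult.assoc)
  then show ?thesis by simp
qed

text \<open>Reflection pairs node \<open>k\<close> with node \<open>N - k\<close> and flips the sign
  of the sample but not of the cosine. For \<open>j = 0\<close> the even-indexed nodes form a grid
  of \<open>M\<close> nodes, to which the same argument applies.\<close>

lemma cos_coeff_odd:
  assumes "b > 0" "M > 0" "odd_fun f" and per: "\<And>x. f (x + 2 * b) = f x"
  shows "cos_coeff b f M j = 0"
proof -
  \<comment> \<open>The unpaired node is \<open>- b\<close>: periodicity gives
    \<open>f b = f (- b)\<close> and oddness gives \<open>f b = - f (- b)\<close>.\<close>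
  have 0: "f (node b N 0) = 0" for N
    using per[of "- b"] \<open>odd_fun f\<close> by (simp add: node_def odd_fun_def)
  have refl: "f (node b N (N - k)) = - f (node b N k)" if "k < N" for k N
    using that node_reflect[of b N k] assms by (simp add: odd_fun_def)
  show ?thesis
  proof (cases "j = 0")
    case True
    have "(\<Sum>i<M. f (node b (2 * M) (2 * i))) = 0"
      unfolding node_double by (rule sum_antisymmetric) (use 0 refl in auto)
    with True show ?thesis by (simp add: cos_coeff_def)
  next
    case False
    have "(\<Sum>k<2*M. (-1) ^ j * f (node b (2 * M) k) * cos (2 * pi * real j * real k / real (2 * M))) = 0"
    proof (rule sum_antisymmetric)
      fix k assume k: "0 < k" "k < 2 * M"
      have "2 * pi * real j * real (2 * M - k) / real (2 * M) = 2 * pi * j - 2 * pi * real j * real k / real (2 * M)"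
        using k by (simp add: field_simps of_nat_diff)
      then show "(-1) ^ j * f (node b (2 * M) (2 * M - k)) * cos (2 * pi * real j * real (2 * M - k) / real (2 * M))
        = - ((-1) ^ j * f (node b (2 * M) k) * cos (2 * pi * real j * real k / real (2 * M)))"
        using refl[OF k(2)] cos_int_2pin[of "int j"] sin_int_2pin[of "int j"] by (simp add: cos_diff)
    qed (simp add: 0)
    with False show ?thesis by (simp add: cos_coeff_def Let_def)
  qed
qed

text \<open>Reflection now flips the sine and keeps the sample; the unpaired term
  \<open>k = 0\<close> vanishes with \<open>sin 0\<close>.\<close>

lemma sin_coeff_even:
  assumes "b > 0" "M > 0" "even_fun f"
  shows "sin_coeff b f M j = 0"
proof -
  have refl: "f (node b N (N - k)) = f (node b N k)" if "k < N" for k N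
    using that node_reflect[of b N k] assms by (simp add: even_fun_def)
  have "(\<Sum>k<2*M. (-1) ^ j * f (node b (2 * M) k) * sin (2 * pi * real j * real k / real (2 * M))) = 0"
  proof (rule sum_antisymmetric)
    fix k assume k: "0 < k" "k < 2 * M"
    have "2 * pi * real j * real (2 * M - k) / real (2 * M) = 2 * pi * j - 2 * pi * real j * real k / real (2 * M)"
      using k by (simp add: field_simps of_nat_diff)
    then show "(-1) ^ j * f (node b (2 * M) (2 * M - k)) * sin (2 * pi * real j * real (2 * M - k) / real (2 * M))
      = - ((-1) ^ j * f (node b (2 * M) k) * sin (2 * pi * real j * real k / real (2 * M)))"
      using refl[OF k(2)] cos_int_2pin[of "int j"] sin_int_2pin[of "int j"] by (simp add: sin_diff)
  qed simp
  then show ?thesis by (simp add: sin_coeff_def Let_def)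
qed

lemma trig_interpolant_eq:
  assumes "b > 0" "M > 0" "even_fun f \<or> odd_fun f" and per: "\<And>x. f (x + 2 * b) = f x"
  shows "trig_interpolant b f M = interpolant b f M 0"
proof
  fix x
  have interp_term: "Re (interp_coeff b f M j * cis (pi * j * x / b))
     = cos_coeff b f M j * cos (j * pi * x / b) + sin_coeff b f M j * sin (j * pi * x / b)" for j
    \<comment> \<open>At \<open>j = 0\<close> the sine term is zero and the constant coefficients
      agree by definition.\<close>
    using Re_interp_term[OF assms(1,2), of j f "pi * j * x / b"]
    by (cases "j = 0") (simp_all add: mult_ac interp_coeff_def cos_coeff_def)
  show "trig_interpolant b f M x = interpolant b f M 0 x"
  proof (cases "even_fun f")
    case True
    with interp_term show ?thesis
      using sin_coeff_even[OF assms(1,2)]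
      by (simp add: trig_interpolant_def interpolant_def trig_poly_def)
  next
    case False
    with interp_term show ?thesis
      using cos_coeff_odd[of b M f] assms
      by (simp add: trig_interpolant_def interpolant_def trig_poly_def)
  qed
qed

section \<open>Uniform error bounds for the interpolant and its derivatives\<close>

theorem theorem2p3:
  fixes b :: real and K :: nat
  assumes "b > 0" and "K \<ge> 1"
  shows "\<forall>D::real. D \<ge> 0 \<longrightarrow>
    (\<exists>C1 C2 :: real. \<forall>(f :: real \<Rightarrow> real) (N :: nat) (M :: nat).
       (\<forall>x. f (x + 2 * b) = f x) \<longrightarrow>
       even_fun f \<or> odd_fun f \<longrightarrow>
       times_differentiable (K + 1) f \<longrightarrow>
       (\<forall>x. \<bar>(deriv ^^ (K + 1)) f x\<bar> \<le> D) \<longrightarrow>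
       N > 0 \<longrightarrow> N = 2 * M \<longrightarrow>
       (\<forall>x. \<bar>trig_interpolant b f M x - f x\<bar> \<le> C1 / real N ^ K \<and>
            (\<forall>k. 1 \<le> k \<and> k < K \<longrightarrow>
               \<bar>(deriv ^^ k) (trig_interpolant b f M) x - (deriv ^^ k) f x\<bar>
                 \<le> C2 / real N ^ (K - k))))"
proof (intro allI impI)
  fix D :: real
  \<comment> \<open>The constant of \<open>interpolant_error\<close> with \<open>C\<close> written
    out, since it has to be fixed before \<open>f\<close>, \<open>N\<close> and
    \<open>M\<close>.\<close>
  define c where "c = 2 * (4 * D * (b / 2) ^ Suc K * (1 + 2 * pi / b) ^ K) * 2 ^ K"
  have main: "\<bar>(deriv ^^ k) (trig_interpolant b f M) x - (deriv ^^ k) f x\<bar> \<le> c / real N ^ (K - k)"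
    if "\<forall>x. f (x + 2 * b) = f x" "even_fun f \<or> odd_fun f" "times_differentiable (K + 1) f"
      "\<forall>x. \<bar>(deriv ^^ (K + 1)) f x\<bar> \<le> D" "N > 0" "N = 2 * M" "k < K" for f N M k x
  proof -
    interpret smooth_periodic b f K D
      by standard (use that \<open>b > 0\<close> in auto)
    have "M > 0" using that by simp
    have "(deriv ^^ k) (trig_interpolant b f M) = interpolant b f M k"
      using trig_interpolant_eq[OF \<open>b > 0\<close> \<open>M > 0\<close>] that
      by (simp add: interpolant_def deriv_pow_trig_poly)
    then show ?thesis
      using interpolant_error[OF \<open>M > 0\<close> \<open>k < K\<close>, of x] that(6) by (simp add: c_def C_def)
  qed
  show "\<exists>C1 C2 :: real. \<forall>(f :: real \<Rightarrow> real) (N :: nat) (M :: nat).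
       (\<forall>x. f (x + 2 * b) = f x) \<longrightarrow>
       even_fun f \<or> odd_fun f \<longrightarrow>
       times_differentiable (K + 1) f \<longrightarrow>
       (\<forall>x. \<bar>(deriv ^^ (K + 1)) f x\<bar> \<le> D) \<longrightarrow>
       N > 0 \<longrightarrow> N = 2 * M \<longrightarrow>
       (\<forall>x. \<bar>trig_interpolant b f M x - f x\<bar> \<le> C1 / real N ^ K \<and>
            (\<forall>k. 1 \<le> k \<and> k < K \<longrightarrow>
               \<bar>(deriv ^^ k) (trig_interpolant b f M) x - (deriv ^^ k) f x\<bar>
                 \<le> C2 / real N ^ (K - k)))"
    \<comment> \<open>The first bound is the case \<open>k = 0\<close>, admissible because
      \<open>K \<ge> 1\<close>; \<open>c\<close> serves as both constants.\<close>
    using main[where k = 0] main \<open>K \<ge> 1\<close>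
    by (intro exI[of _ c] allI impI conjI) auto
qed

end
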